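(* Let $p$ be a prime and let $G$ be a finite non-abelian $p$-group such that the center $Z(G)$ is elementary abelian. Then $\mathrm{Aut}_c(G)=\mathrm{Aut}_z(G)$ if and only if $G$ is a Camina $p$-group of nilpotency class $2$.
   Context: $\mathrm{Aut}_c(G)$ is the group of all class preserving automorphisms of $G$, i.e. automorphisms $\alpha$ such that $\alpha(x)$ is conjugate to $x$ in $G$ for every $x\in G$. $\mathrm{Aut}_z(G)$ is the group of all central automorphisms of $G$, i.e. automorphisms $\phi$ such that $g^{-1}\phi(g)\in Z(G)$ for every $g\in G$. Commutators are $[x,y]=x^{-1}y^{-1}xy$, $\gamma_2(G)$ is the commutator subgroup, and for $y\in G$, $[y,G]$ denotes the set $\{[y,g] : g\in G\}$. For a non-trivial proper normal subgroup $M$ of a finite $p$-group $G$, the pair $(G,M)$ is a Camina pair if $M\subseteq [y,G]$ for all $y\in G\setminus M$; $G$ is a Camina group if $(G,\gamma_2(G))$ is a Camina pair. *)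

theory Defs
  imports "HOL-Algebra.Algebra"
begin

text \<open>Subgroups are carrier sets, as in HOL-Algebra. Automorphisms are the elements of
  \<^const>\<open>auto\<close>, i.e. extensional functions, so that equality of sets of automorphisms is not
  affected by values outside the carrier.\<close>

definition finite_p_group :: "nat \<Rightarrow> ('a, 'b) monoid_scheme \<Rightarrow> bool" where
  "finite_p_group p G \<longleftrightarrow>
     group G \<and> Factorial_Ring.prime p \<and> finite (carrier G) \<and> (\<exists>n. order G = p ^ n)"

definition elementary_abelian :: "nat \<Rightarrow> ('a, 'b) monoid_scheme \<Rightarrow> bool" where
  "elementary_abelian p G \<longleftrightarrow>
     comm_group G \<and> (\<forall>x\<in>carrier G. x [^]\<^bsub>G\<^esub> p = \<one>\<^bsub>G\<^esub>)"

definition group_center :: "('a, 'b) monoid_scheme \<Rightarrow> 'a set" where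
  "group_center G = {z \<in> carrier G. \<forall>g\<in>carrier G. z \<otimes>\<^bsub>G\<^esub> g = g \<otimes>\<^bsub>G\<^esub> z}"

definition group_commutator :: "('a, 'b) monoid_scheme \<Rightarrow> 'a \<Rightarrow> 'a \<Rightarrow> 'a" where
  "group_commutator G x y = inv\<^bsub>G\<^esub> x \<otimes>\<^bsub>G\<^esub> inv\<^bsub>G\<^esub> y \<otimes>\<^bsub>G\<^esub> x \<otimes>\<^bsub>G\<^esub> y"

definition conjugate_in :: "('a, 'b) monoid_scheme \<Rightarrow> 'a \<Rightarrow> 'a \<Rightarrow> bool" where
  "conjugate_in G x y \<longleftrightarrow> (\<exists>g\<in>carrier G. y = inv\<^bsub>G\<^esub> g \<otimes>\<^bsub>G\<^esub> x \<otimes>\<^bsub>G\<^esub> g)"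

definition Aut_c :: "('a, 'b) monoid_scheme \<Rightarrow> ('a \<Rightarrow> 'a) set" where
  "Aut_c G = {\<alpha> \<in> auto G. \<forall>x\<in>carrier G. conjugate_in G x (\<alpha> x)}"

definition Aut_z :: "('a, 'b) monoid_scheme \<Rightarrow> ('a \<Rightarrow> 'a) set" where
  "Aut_z G = {\<phi> \<in> auto G. \<forall>g\<in>carrier G. inv\<^bsub>G\<^esub> g \<otimes>\<^bsub>G\<^esub> \<phi> g \<in> group_center G}"

text \<open>The index is shifted: \<open>lower_central G n\<close> is $\gamma_{n+1}(G)$, so that the nilpotency class
  is the least \<open>n\<close> at which the series is trivial. The nilpotency class is only meaningful for
  nilpotent groups.\<close>

primrec lower_central :: "('a, 'b) monoid_scheme \<Rightarrow> nat \<Rightarrow> 'a set" where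
  "lower_central G 0 = carrier G"
| "lower_central G (Suc n) =
     generate G {group_commutator G x y | x y. x \<in> lower_central G n \<and> y \<in> carrier G}"

definition nilpotent_group :: "('a, 'b) monoid_scheme \<Rightarrow> bool" where
  "nilpotent_group G \<longleftrightarrow> group G \<and> (\<exists>n. lower_central G n = {\<one>\<^bsub>G\<^esub>})"

definition nilpotency_class :: "('a, 'b) monoid_scheme \<Rightarrow> nat" where
  "nilpotency_class G = (LEAST n. lower_central G n = {\<one>\<^bsub>G\<^esub>})"

definition camina_pair :: "('a, 'b) monoid_scheme \<Rightarrow> 'a set \<Rightarrow> bool" where
  "camina_pair G M \<longleftrightarrow>
     M \<lhd> G \<and> M \<noteq> {\<one>\<^bsub>G\<^esub>} \<and> M \<noteq> carrier G \<and>
     (\<forall>y\<in>carrier G - M. M \<subseteq> {group_commutator G y g | g. g \<in> carrier G})"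

text \<open>The commutator subgroup is the library's \<open>derived G (carrier G)\<close>. It is generated by the
  elements \<open>x \<otimes> y \<otimes> inv x \<otimes> inv y\<close>; the lemma \<open>lower_central_1\<close> below shows that the
  commutators \<^const>\<open>group_commutator\<close> generate the same subgroup.\<close>

definition camina_group :: "('a, 'b) monoid_scheme \<Rightarrow> bool" where
  "camina_group G \<longleftrightarrow> camina_pair G (derived G (carrier G))"

context group
begin

lemma lower_central_1: "lower_central G 1 = derived G (carrier G)"
proof -
  have "{group_commutator G x y | x y. x \<in> carrier G \<and> y \<in> carrier G} = derived_set G (carrier G)"
  proof (intro equalityI subsetI)
    fix c assume "c \<in> {group_commutator G x y | x y. x \<in> carrier G \<and> y \<in> carrier G}"
    then obtain x y where xy: "x \<in> carrier G" "y \<in> carrier G" and c: "c = group_commutator G x y"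
      by blast
    then have "c = inv x \<otimes> inv y \<otimes> inv (inv x) \<otimes> inv (inv y)"
      by (simp add: group_commutator_def)
    then show "c \<in> derived_set G (carrier G)"
      using xy by blast
  next
    fix c assume "c \<in> derived_set G (carrier G)"
    then obtain x y where xy: "x \<in> carrier G" "y \<in> carrier G"
      and c: "c = x \<otimes> y \<otimes> inv x \<otimes> inv y"
      by blast
    then have "c = group_commutator G (inv x) (inv y)"
      by (simp add: group_commutator_def)
    then show "c \<in> {group_commutator G x y | x y. x \<in> carrier G \<and> y \<in> carrier G}"
      using xy by blast
  qed
  then show ?thesis
    by (simp add: derived_def)
qed

end

end

theory Submission
  imports Defs "HOL-Number_Theory.Cong"
begin

text \<open>Suppose that the class preserving and the central automorphisms coincide. Inner automorphisms
  are then central, so \<open>G\<close> has class 2, and as the center \<open>Z\<close> has exponent \<open>p\<close>, all \<open>p\<close>-th powers are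
  central: the subgroup \<open>H\<close> generated by the commutators and the \<open>p\<close>-th powers lies in \<open>Z\<close>.
  For \<open>x \<notin> H\<close> the elementary abelian quotient \<open>G/H\<close> carries a homomorphism \<open>k\<close> to the integers
  modulo \<open>p\<close> with \<open>k x = 1\<close>, and for each \<open>w \<in> H\<close> the map \<open>g \<mapsto> g w\<^sup>k\<^sup>(\<^sup>g\<^sup>)\<close> is a central automorphism.
  It is class preserving, so \<open>w\<close> is a commutator \<open>[x,g]\<close>. If \<open>x\<close> were central this would force \<open>H\<close>
  to be trivial, so \<open>Z = H\<close>. Hence all of \<open>Z\<close> consists of commutators \<open>[x,g]\<close>, for every \<open>x \<notin> Z\<close>;
  thus \<open>Z\<close> is the commutator subgroup and \<open>G\<close> is a Camina group. Conversely, in a Camina group of class 2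
  the center is the commutator subgroup, which every central automorphism fixes pointwise.\<close>

section \<open>Functionals modulo \<open>p\<close> on elementary abelian groups\<close>

lemma (in group) mult_inv_cancel_left:
  assumes "x \<in> carrier G" "z \<in> carrier G"
  shows "x \<otimes> (inv x \<otimes> z) = z" "inv x \<otimes> (x \<otimes> z) = z"
  using assms by (simp_all flip: m_assoc)

text \<open>This is a linear functional over the field with \<open>p\<close> elements, normalised at
  \<open>a\<close>. Integer values read modulo \<open>p\<close> can later serve directly as
  exponents.\<close>

lemma (in comm_group) elementary_abelian_functional:
  assumes fin: "finite (carrier G)" and p: "Factorial_Ring.prime p"
    and exp: "\<And>x. x \<in> carrier G \<Longrightarrow> x [^] p = \<one>"
    and a: "a \<in> carrier G" "a \<noteq> \<one>"
  obtains k :: "'a \<Rightarrow> int"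
  where "\<And>x y. x \<in> carrier G \<Longrightarrow> y \<in> carrier G \<Longrightarrow> [k (x \<otimes> y) = k x + k y] (mod int p)"
    and "[k a = 1] (mod int p)"
proof -
  have exp_dvd: "x [^] i = \<one>" if x: "x \<in> carrier G" and "int p dvd i" for x and i :: int
  proof -
    obtain j where "i = int p * j" using \<open>int p dvd i\<close> ..
    then show ?thesis using exp[OF x] x by (simp flip: int_pow_pow add: int_pow_int)
  qed
  have unit: "\<exists>j. int p dvd i * j - 1" if "\<not> int p dvd i" for i
  proof -
    have "coprime i (int p)"
      using that p prime_imp_coprime[of "int p" i] by (simp add: coprime_commute)
    then show ?thesis
      by (metis cong_iff_dvd_diff cong_solve_coprime_int)
  qed
  \<comment> \<open>A subgroup maximal among those avoiding \<open>a\<close> is a complement of \<open>\<langle>a\<rangle>\<close>; \<open>k\<close> is the exponent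
    of the projection to \<open>\<langle>a\<rangle>\<close>.\<close>
  define S where "S = {M. subgroup M G \<and> a \<notin> M}"
  have "finite S"
    by (rule finite_subset[of _ "Pow (carrier G)"]) (use fin in \<open>auto simp: S_def dest: subgroup.subset\<close>)
  moreover have "{\<one>} \<in> S"
    using a triv_subgroup by (simp add: S_def)
  ultimately obtain M where "M \<in> S" and max: "\<And>K. K \<in> S \<Longrightarrow> M \<subseteq> K \<Longrightarrow> K = M"
    using finite_has_maximal[of S] by (metis empty_iff)
  then have aM: "a \<notin> M" by (simp add: S_def)
  interpret M: subgroup M G using \<open>M \<in> S\<close> by (simp add: S_def)
  have pow_M: "x [^] i \<in> M" if "x \<in> M" for x and i :: int
    using subgroup_int_pow_closed[OF M.subgroup_axioms that] .
  \<comment> \<open>Otherwise \<open>i\<close> is invertible modulo \<open>p\<close>, and a suitable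
    power of \<open>a [^] i\<close> is \<open>a\<close> itself, which would then lie in
    \<open>M\<close>.\<close>
  have a_pow: "int p dvd i" if i: "a [^] i \<in> M" for i :: int
  proof (rule ccontr)
    assume "\<not> int p dvd i"
    then obtain j where "int p dvd i * j - 1" using unit by blast
    then have "a [^] (i * j - 1) = \<one>" by (rule exp_dvd[OF a(1)])
    then have "a [^] (i * j) = a"
      using a by (metis diff_add_cancel int_pow_1 int_pow_mult l_one)
    then show False
      using pow_M[OF i, of j] a aM by (simp add: int_pow_pow)
  qed
  have "\<exists>i::int. x \<otimes> inv (a [^] i) \<in> M" if x: "x \<in> carrier G" for x
  proof (cases "x \<in> M")
    case True
    then show ?thesis by (intro exI[of _ "0::int"]) (simp add: x)
  next
    case False
    \<comment> \<open>\<open>K\<close> is the subgroup generated by \<open>M\<close> and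
      \<open>x\<close>. It is strictly larger than \<open>M\<close>, so maximality forces
      \<open>a\<close> into it.\<close>
    define K where "K = {m \<otimes> x [^] j | m j. m \<in> M \<and> (j::int) \<in> UNIV}"
    have K: "m \<otimes> x [^] j \<in> K" if "m \<in> M" for m and j :: int
      using that by (auto simp: K_def)
    have "subgroup K G"
    proof (rule subgroupI)
      show "K \<subseteq> carrier G" using x by (auto simp: K_def)
      show "K \<noteq> {}" using K[OF M.one_closed] by blast
    next
      fix u assume "u \<in> K"
      then obtain m j where m: "m \<in> M" "u = m \<otimes> x [^] (j::int)" by (auto simp: K_def)
      then have "inv u = inv m \<otimes> x [^] (- j)"
        using x by (simp add: inv_mult int_pow_neg)
      then show "inv u \<in> K" using K m by simp
    next
      fix u v assume "u \<in> K" "v \<in> K"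
      then obtain m j n i where m: "m \<in> M" "u = m \<otimes> x [^] (j::int)"
        "n \<in> M" "v = n \<otimes> x [^] (i::int)" by (auto simp: K_def)
      then have "u \<otimes> v = (m \<otimes> n) \<otimes> x [^] (j + i)"
        using x by (simp add: int_pow_mult m_ac)
      then show "u \<otimes> v \<in> K" using K m by simp
    qed
    moreover have "M \<subseteq> K" using K[of _ 0] by force
    moreover have "x \<in> K" using K[OF M.one_closed, of 1] x by simp
    ultimately have "a \<in> K" using max[of K] False by (auto simp: S_def)
    then obtain m j where m: "m \<in> M" "a = m \<otimes> x [^] (j::int)" by (auto simp: K_def)
    have "\<not> int p dvd j"
    proof
      assume "int p dvd j"
      then show False using m aM exp_dvd[OF x] by simp
    qed
    \<comment> \<open>With \<open>t\<close> inverse to \<open>j\<close> modulo \<open>p\<close>, the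
      \<open>t\<close>-th power of \<open>a = m \<otimes> x [^] j\<close> isolates \<open>x\<close>,
      so \<open>t\<close> is the exponent sought.\<close>
    then obtain t where "int p dvd j * t - 1" using unit by blast
    then have "x [^] (j * t - 1) = \<one>" by (rule exp_dvd[OF x])
    then have "x [^] (j * t) = x"
      using x by (metis diff_add_cancel int_pow_1 int_pow_mult l_one)
    then have "a [^] t = m [^] t \<otimes> x"
      using m x by (simp add: int_pow_distrib int_pow_pow)
    then have "x \<otimes> inv (a [^] t) = inv (m [^] t)"
      using x m by (simp add: inv_mult_group mult_inv_cancel_left)
    then show ?thesis using pow_M[OF m(1), of t] by (intro exI[of _ t]) simp
  qed
  then obtain k where k: "\<And>x. x \<in> carrier G \<Longrightarrow> x \<otimes> inv (a [^] (k x :: int)) \<in> M" by metis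
  show thesis
  proof
    fix x y assume xy: "x \<in> carrier G" "y \<in> carrier G"
    \<comment> \<open>\<open>r g\<close> is the component of \<open>g\<close> in \<open>M\<close>.
      Comparing two decompositions of \<open>x \<otimes> y\<close> puts a power of \<open>a\<close>
      into \<open>M\<close>, so \<open>p\<close> divides its exponent.\<close>
    define r where "r g = g \<otimes> inv (a [^] k g)" for g
    have r: "r g \<in> M" if "g \<in> carrier G" for g using k that by (simp add: r_def)
    have g: "g = r g \<otimes> a [^] k g" if "g \<in> carrier G" for g
      using that a by (simp add: r_def m_assoc)
    have "a [^] (k (x \<otimes> y) - (k x + k y)) = r x \<otimes> r y \<otimes> inv (r (x \<otimes> y))"
    proof -
      have "r (x \<otimes> y) \<otimes> a [^] k (x \<otimes> y) = (r x \<otimes> a [^] k x) \<otimes> (r y \<otimes> a [^] k y)"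
        using g xy by simp
      also have "\<dots> = (r x \<otimes> r y) \<otimes> a [^] (k x + k y)"
        using a r xy by (simp add: int_pow_mult m_ac)
      finally have e: "r (x \<otimes> y) \<otimes> a [^] k (x \<otimes> y) = (r x \<otimes> r y) \<otimes> a [^] (k x + k y)" .
      have "a [^] k (x \<otimes> y) = inv (r (x \<otimes> y)) \<otimes> ((r x \<otimes> r y) \<otimes> a [^] (k x + k y))"
        unfolding e[symmetric] using a r xy by (simp add: mult_inv_cancel_left)
      then show ?thesis using a r xy by (simp add: int_pow_diff m_ac)
    qed
    then show "[k (x \<otimes> y) = k x + k y] (mod int p)"
      using a_pow r xy by (simp add: cong_iff_dvd_diff)
  next
    have "a [^] (1 - k a) \<in> M"
      using k[OF a(1)] a by (simp add: int_pow_diff)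
    then show "[k a = 1] (mod int p)"
      using a_pow cong_iff_dvd_diff cong_sym by blast
  qed
qed

section \<open>The center, and functionals on quotients\<close>

lemma (in group) center_subgroup: "subgroup (group_center G) G"
proof (rule subgroupI)
  show "group_center G \<subseteq> carrier G" by (auto simp: group_center_def)
  have "\<one> \<in> group_center G" by (simp add: group_center_def)
  then show "group_center G \<noteq> {}" by blast
next
  fix a assume "a \<in> group_center G"
  then have a: "a \<in> carrier G" "\<And>g. g \<in> carrier G \<Longrightarrow> a \<otimes> g = g \<otimes> a"
    by (auto simp: group_center_def)
  then have "inv a \<otimes> g = g \<otimes> inv a" if "g \<in> carrier G" for g
    using that by (metis inv_closed inv_inv inv_mult_group)
  then show "inv a \<in> group_center G" using a by (simp add: group_center_def)
next
  fix a b assume "a \<in> group_center G" "b \<in> group_center G"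
  then have a: "a \<in> carrier G" "\<And>g. g \<in> carrier G \<Longrightarrow> a \<otimes> g = g \<otimes> a"
    and b: "b \<in> carrier G" "\<And>g. g \<in> carrier G \<Longrightarrow> b \<otimes> g = g \<otimes> b"
    by (auto simp: group_center_def)
  have "a \<otimes> b \<otimes> g = g \<otimes> (a \<otimes> b)" if g: "g \<in> carrier G" for g
  proof -
    have "a \<otimes> b \<otimes> g = a \<otimes> g \<otimes> b" using a(1) b g by (simp add: m_assoc)
    then show ?thesis using a b(1) g by (simp add: m_assoc)
  qed
  then show "a \<otimes> b \<in> group_center G" using a(1) b(1) by (simp add: group_center_def)
qed

lemma group_centerD:
  assumes "z \<in> group_center G"
  shows "z \<in> carrier G" "g \<in> carrier G \<Longrightarrow> z \<otimes>\<^bsub>G\<^esub> g = g \<otimes>\<^bsub>G\<^esub> z"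
  using assms unfolding group_center_def by blast+

lemma (in group) central_subgroup_normal:
  assumes "subgroup H G" "H \<subseteq> group_center G"
  shows "H \<lhd> G"
proof (rule normal_invI[OF assms(1)])
  fix x h assume "x \<in> carrier G" "h \<in> H"
  then show "x \<otimes> h \<otimes> inv x \<in> H"
    using assms by (metis group_centerD inv_solve_right' subgroup.mem_carrier subsetD m_closed)
qed

lemma (in normal) comm_group_FactGroup:
  assumes "derived G (carrier G) \<subseteq> H"
  shows "comm_group (G Mod H)"
proof (rule group.group_comm_groupI[OF factorgroup_is_group])
  fix U V assume "U \<in> carrier (G Mod H)" "V \<in> carrier (G Mod H)"
  then obtain x y where xy: "x \<in> carrier G" "y \<in> carrier G" "U = H #> x" "V = H #> y"
    by (auto simp: carrier_FactGroup)
  have "x \<otimes> y \<otimes> inv x \<otimes> inv y \<in> H"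
    using assms xy derived_set_incl[of "carrier G"] by (auto simp: derived_def intro: generate.incl)
  then have "H #> ((x \<otimes> y) \<otimes> inv (y \<otimes> x)) = H"
    using xy by (simp add: inv_mult_group m_assoc coset_join2 subgroup_axioms)
  then have "H #> (x \<otimes> y) = H #> (y \<otimes> x)"
    using xy by (intro coset_mult_inv1) (auto simp: subset)
  then show "U \<otimes>\<^bsub>G Mod H\<^esub> V = V \<otimes>\<^bsub>G Mod H\<^esub> U"
    using xy by (simp add: rcos_sum)
qed

text \<open>Since \<open>H\<close> contains all commutators and \<open>p\<close>-th powers,
  \<open>G Mod H\<close> is elementary abelian. The functional is found there and pulled back to
  \<open>G\<close>.\<close>

lemma (in normal) elementary_abelian_quotient_functional:
  fixes p :: nat
  assumes fin: "finite (carrier G)" and p: "Factorial_Ring.prime p"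
    and der: "derived G (carrier G) \<subseteq> H"
    and exp: "\<And>x. x \<in> carrier G \<Longrightarrow> x [^] p \<in> H"
    and a: "a \<in> carrier G" "a \<notin> H"
  obtains k :: "'a \<Rightarrow> int"
  where "\<And>x y. x \<in> carrier G \<Longrightarrow> y \<in> carrier G \<Longrightarrow> [k (x \<otimes> y) = k x + k y] (mod int p)"
    and "[k a = 1] (mod int p)"
    and "\<And>h. h \<in> H \<Longrightarrow> [k h = 0] (mod int p)"
proof -
  interpret Q: comm_group "G Mod H" by (rule comm_group_FactGroup[OF der])
  have coset: "H #> x \<in> carrier (G Mod H)" if "x \<in> carrier G" for x
    using that by (simp add: carrier_FactGroup)
  obtain k :: "'a set \<Rightarrow> int" where
    add: "\<And>U V. U \<in> carrier (G Mod H) \<Longrightarrow> V \<in> carrier (G Mod H)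
      \<Longrightarrow> [k (U \<otimes>\<^bsub>G Mod H\<^esub> V) = k U + k V] (mod int p)"
    and one: "[k (H #> a) = 1] (mod int p)"
  proof (rule Q.elementary_abelian_functional[OF _ p])
    show "finite (carrier (G Mod H))" using fin by (simp add: carrier_FactGroup)
    show "H #> a \<in> carrier (G Mod H)" using a coset by blast
    show "H #> a \<noteq> \<one>\<^bsub>G Mod H\<^esub>" using a coset_join1 subgroup_axioms by auto
  next
    fix U assume "U \<in> carrier (G Mod H)"
    then obtain x where x: "x \<in> carrier G" "U = H #> x" by (auto simp: carrier_FactGroup)
    then show "U [^]\<^bsub>G Mod H\<^esub> p = \<one>\<^bsub>G Mod H\<^esub>"
      using exp by (simp add: FactGroup_pow normal_axioms coset_join2 subgroup_axioms)
  qed blast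
  show thesis
  proof
    fix x y assume "x \<in> carrier G" "y \<in> carrier G"
    then show "[k (H #> (x \<otimes> y)) = k (H #> x) + k (H #> y)] (mod int p)"
      using add[OF coset coset] by (simp add: rcos_sum)
  next
    show "[k (H #> a) = 1] (mod int p)" by (rule one)
  next
    fix h assume h: "h \<in> H"
    then have "H #> h = \<one>\<^bsub>G Mod H\<^esub>" using rcos_const is_group by simp
    \<comment> \<open>The identity coset is its own square, so additivity makes its value congruent
      to twice itself, hence to 0.\<close>
    then show "[k (H #> h) = 0] (mod int p)"
      using add[OF Q.one_closed Q.one_closed] by (metis Q.l_one Q.one_closed cong_add_lcancel_0 cong_sym)
  qed
qed

section \<open>Construction of central automorphisms\<close>

lemma (in group) mult_central_hom_in_Aut_z:
  assumes c: "c \<in> hom G G" and center: "\<And>g. g \<in> carrier G \<Longrightarrow> c g \<in> group_center G"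
    and c_c: "\<And>g. g \<in> carrier G \<Longrightarrow> c (c g) = \<one>"
  shows "(\<lambda>g\<in>carrier G. g \<otimes> c g) \<in> Aut_z G"
proof -
  interpret c: group_hom G G c
    by (simp add: c group_hom_axioms_def group_hom_def)
  \<comment> \<open>Since \<open>c\<close> kills its own values,
    \<open>c (g \<otimes> c g) = c g\<close>, so dividing by the value of \<open>c\<close> undoes
    the map.\<close>
  have "bij_betw (\<lambda>g. g \<otimes> c g) (carrier G) (carrier G)"
    by (rule bij_betw_byWitness[where f' = "\<lambda>g. g \<otimes> inv (c g)"]) (auto simp: c_c m_assoc)
  moreover have "(\<lambda>g\<in>carrier G. g \<otimes> c g) \<in> hom G G"
  proof (rule homI)
    fix x y assume xy: "x \<in> carrier G" "y \<in> carrier G"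
    have "y \<otimes> (c x \<otimes> c y) = c x \<otimes> (y \<otimes> c y)"
      using xy center[OF xy(1)] by (simp add: m_assoc[symmetric] group_centerD(2))
    then show "(\<lambda>g\<in>carrier G. g \<otimes> c g) (x \<otimes> y)
        = (\<lambda>g\<in>carrier G. g \<otimes> c g) x \<otimes> (\<lambda>g\<in>carrier G. g \<otimes> c g) y"
      using xy by (simp add: m_assoc)
  qed simp
  ultimately have "(\<lambda>g\<in>carrier G. g \<otimes> c g) \<in> auto G"
    by (simp add: auto_def Bij_def)
  moreover have "inv g \<otimes> (g \<otimes> c g) \<in> group_center G" if "g \<in> carrier G" for g
    using that center by (simp add: m_assoc[symmetric])
  ultimately show ?thesis by (simp add: Aut_z_def)
qed

text \<open>The homomorphism \<open>c g = w [^] k g\<close> respects congruences of exponents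
  because \<open>w [^] p = \<one>\<close>. Its values lie in \<open>H\<close>, where
  \<open>k\<close> vanishes modulo \<open>p\<close>, so \<open>c\<close> kills its own
  values.\<close>

lemma (in normal) central_automorphism:
  fixes p :: nat
  assumes "finite (carrier G)" and "Factorial_Ring.prime p"
    and "derived G (carrier G) \<subseteq> H"
    and "\<And>x. x \<in> carrier G \<Longrightarrow> x [^] p \<in> H"
    and a: "a \<in> carrier G" "a \<notin> H"
    and w: "w \<in> H" "w \<in> group_center G" "w [^] p = \<one>"
  obtains \<phi> where "\<phi> \<in> Aut_z G" and "\<phi> a = a \<otimes> w"
proof -
  obtain k :: "'a \<Rightarrow> int" where
    add: "\<And>x y. x \<in> carrier G \<Longrightarrow> y \<in> carrier G \<Longrightarrow> [k (x \<otimes> y) = k x + k y] (mod int p)"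
    and ka: "[k a = 1] (mod int p)"
    and k0: "\<And>h. h \<in> H \<Longrightarrow> [k h = 0] (mod int p)"
    using elementary_abelian_quotient_functional[OF assms(1-6)] by blast
  have wG: "w \<in> carrier G" using w(1) by (rule mem_carrier)
  have pow_cong: "w [^] i = w [^] j" if ij: "[i = j] (mod int p)" for i j :: int
  proof -
    obtain t where "i = j + int p * t"
      using cong_sym[OF ij] unfolding cong_iff_lin by blast
    then show ?thesis
      using w wG by (simp add: int_pow_mult int_pow_int flip: int_pow_pow)
  qed
  define c where "c g = w [^] k g" for g
  have "c \<in> hom G G"
  proof (rule homI)
    fix x y assume "x \<in> carrier G" "y \<in> carrier G"
    from pow_cong[OF add[OF this]] show "c (x \<otimes> y) = c x \<otimes> c y"
      using wG by (simp add: c_def int_pow_mult)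
  qed (simp add: c_def wG)
  moreover have "c g \<in> group_center G" for g
    unfolding c_def by (rule subgroup_int_pow_closed[OF center_subgroup w(2)])
  moreover have "c (c g) = \<one>" for g
    using pow_cong[OF k0, of "c g"] subgroup_int_pow_closed[OF subgroup_axioms w(1)]
    by (simp add: c_def)
  ultimately have "(\<lambda>g\<in>carrier G. g \<otimes> c g) \<in> Aut_z G"
    by (rule mult_central_hom_in_Aut_z)
  moreover have "c a = w" using pow_cong[OF ka] wG by (simp add: c_def)
  ultimately show thesis using that a by auto
qed

section \<open>Commutators and nilpotency class 2\<close>

lemma (in group) group_commutator_closed [simp]:
  "x \<in> carrier G \<Longrightarrow> y \<in> carrier G \<Longrightarrow> group_commutator G x y \<in> carrier G"
  by (simp add: group_commutator_def)

lemma (in group) mult_group_commutator: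
  assumes "x \<in> carrier G" "y \<in> carrier G"
  shows "x \<otimes> group_commutator G x y = inv y \<otimes> x \<otimes> y"
  using assms by (simp add: group_commutator_def m_assoc mult_inv_cancel_left)

lemma (in group) group_commutator_eq_iff:
  assumes "x \<in> carrier G" "y \<in> carrier G" "c \<in> carrier G"
  shows "group_commutator G x y = c \<longleftrightarrow> inv y \<otimes> x \<otimes> y = x \<otimes> c"
  using assms by (simp flip: mult_group_commutator)

lemma (in group) group_commutator_eq_one_iff:
  assumes "x \<in> carrier G" "y \<in> carrier G"
  shows "group_commutator G x y = \<one> \<longleftrightarrow> x \<otimes> y = y \<otimes> x"
proof -
  have "inv y \<otimes> (x \<otimes> y) = x \<longleftrightarrow> y \<otimes> (inv y \<otimes> (x \<otimes> y)) = y \<otimes> x"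
    using assms by simp
  also have "y \<otimes> (inv y \<otimes> (x \<otimes> y)) = x \<otimes> y"
    using assms by (simp add: mult_inv_cancel_left)
  finally show ?thesis using assms by (simp add: group_commutator_eq_iff m_assoc)
qed

text \<open>Conjugating \<open>x\<close> by \<open>g\<close> multiplies it on the right by
  \<open>group_commutator G x g\<close>. This links class preserving maps to the sets in the Camina
  condition.\<close>

lemma (in group) conjugate_in_mult_iff:
  assumes "x \<in> carrier G" "w \<in> carrier G"
  shows "conjugate_in G x (x \<otimes> w) \<longleftrightarrow> w \<in> {group_commutator G x g | g. g \<in> carrier G}"
proof -
  have "x \<otimes> w = inv g \<otimes> x \<otimes> g \<longleftrightarrow> w = group_commutator G x g" if "g \<in> carrier G" for g
    using assms that group_commutator_eq_iff[of x g w] by metis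
  then show ?thesis by (auto simp: conjugate_in_def)
qed

lemma (in group) derived_eq:
  "derived G (carrier G)
     = generate G {group_commutator G x y | x y. x \<in> carrier G \<and> y \<in> carrier G}"
  using lower_central_1 by simp

lemma (in group) group_commutator_in_derived:
  assumes "x \<in> carrier G" "y \<in> carrier G"
  shows "group_commutator G x y \<in> derived G (carrier G)"
  unfolding derived_eq using assms by (intro generate.incl) blast

lemma (in group) derived_subset_iff:
  assumes "subgroup H G"
  shows "derived G (carrier G) \<subseteq> H
    \<longleftrightarrow> (\<forall>x\<in>carrier G. \<forall>y\<in>carrier G. group_commutator G x y \<in> H)"
proof
  assume "\<forall>x\<in>carrier G. \<forall>y\<in>carrier G. group_commutator G x y \<in> H"
  then show "derived G (carrier G) \<subseteq> H"
    unfolding derived_eq by (intro generate_subgroup_incl[OF _ assms]) blast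
qed (use group_commutator_in_derived in blast)

lemma (in group) derived_eq_one_iff: "derived G (carrier G) = {\<one>} \<longleftrightarrow> comm_group G"
proof
  assume "derived G (carrier G) = {\<one>}"
  then show "comm_group G"
    using group_commutator_in_derived group_commutator_eq_one_iff
    by (intro group_comm_groupI) auto
next
  assume "comm_group G"
  then show "derived G (carrier G) = {\<one>}" by (simp add: comm_group.derived_eq_singleton)
qed

lemma (in group) lower_central_2_eq_one_iff:
  "lower_central G 2 = {\<one>} \<longleftrightarrow> derived G (carrier G) \<subseteq> group_center G"
proof -
  let ?C = "{group_commutator G x y | x y. x \<in> derived G (carrier G) \<and> y \<in> carrier G}"
  have D: "x \<in> carrier G" if "x \<in> derived G (carrier G)" for x
    using that derived_in_carrier by blast
  have "lower_central G 2 = generate G ?C"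
    using lower_central_1 by (simp add: numeral_2_eq_2)
  moreover have "generate G ?C = {\<one>} \<longleftrightarrow> (\<forall>c\<in>?C. c = \<one>)"
  proof
    assume "\<forall>c\<in>?C. c = \<one>"
    then have "generate G ?C \<subseteq> {\<one>}" by (intro generate_subgroup_incl triv_subgroup) blast
    then show "generate G ?C = {\<one>}" using generate.one by blast
  next
    assume "generate G ?C = {\<one>}"
    then show "\<forall>c\<in>?C. c = \<one>" using generate.incl[of _ ?C G] by simp
  qed
  moreover have "(\<forall>c\<in>?C. c = \<one>)
      \<longleftrightarrow> (\<forall>x\<in>derived G (carrier G). \<forall>y\<in>carrier G. group_commutator G x y = \<one>)"
    by blast
  moreover have "\<dots> \<longleftrightarrow> derived G (carrier G) \<subseteq> group_center G"
    using D by (auto simp: group_center_def subset_iff group_commutator_eq_one_iff)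
  ultimately show ?thesis by blast
qed

lemma (in group) nilpotency_class_2_iff:
  assumes "\<not> comm_group G"
  shows "nilpotent_group G \<and> nilpotency_class G = 2
    \<longleftrightarrow> derived G (carrier G) \<subseteq> group_center G"
proof
  assume "nilpotent_group G \<and> nilpotency_class G = 2"
  \<comment> \<open>Nilpotency ensures that the least index defining \<open>nilpotency_class\<close>
    is attained.\<close>
  then have "lower_central G 2 = {\<one>}"
    unfolding nilpotent_group_def nilpotency_class_def by (metis (mono_tags, lifting) LeastI_ex)
  then show "derived G (carrier G) \<subseteq> group_center G"
    by (simp add: lower_central_2_eq_one_iff)
next
  assume "derived G (carrier G) \<subseteq> group_center G"
  then have 2: "lower_central G 2 = {\<one>}"
    by (simp add: lower_central_2_eq_one_iff)
  have 1: "lower_central G 1 \<noteq> {\<one>}"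
    using assms by (simp only: lower_central_1 derived_eq_one_iff not_False_eq_True)
  \<comment> \<open>A trivial carrier would make the derived subgroup trivial as well.\<close>
  have 0: "lower_central G 0 \<noteq> {\<one>}"
    using 1 lower_central_1 derived_in_carrier[of "carrier G"] derived_is_subgroup[of "carrier G"]
    by (auto dest: subgroup.one_closed)
  have "nilpotency_class G = 2"
    unfolding nilpotency_class_def
  proof (rule Least_equality)
    show "lower_central G 2 = {\<one>}" by (rule 2)
  next
    fix n assume "lower_central G n = {\<one>}"
    with 0 1 have "n \<noteq> 0" "n \<noteq> 1" by metis+
    then show "2 \<le> n" by simp
  qed
  then show "nilpotent_group G \<and> nilpotency_class G = 2"
    using 2 is_group by (auto simp: nilpotent_group_def)
qed

lemma (in group) conjugation_in_Aut_c:
  assumes g: "g \<in> carrier G"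
  shows "(\<lambda>x\<in>carrier G. inv g \<otimes> x \<otimes> g) \<in> Aut_c G"
proof -
  have "bij_betw (\<lambda>x. inv g \<otimes> x \<otimes> g) (carrier G) (carrier G)"
    by (rule bij_betw_byWitness[where f' = "\<lambda>x. g \<otimes> x \<otimes> inv g"])
      (auto simp: g m_assoc mult_inv_cancel_left)
  moreover have "(\<lambda>x\<in>carrier G. inv g \<otimes> x \<otimes> g) \<in> hom G G"
    by (rule homI) (simp_all add: g m_assoc mult_inv_cancel_left)
  ultimately show ?thesis
    using g by (auto simp: Aut_c_def auto_def Bij_def conjugate_in_def)
qed

text \<open>The commutator of \<open>x\<close> and \<open>y\<close> is central, so the commutator of
  \<open>x [^] n\<close> and \<open>y\<close> is its \<open>n\<close>-th power, which the exponent
  of the center makes trivial.\<close>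

lemma (in group) class_2_pow_central:
  fixes n :: nat
  assumes cl2: "derived G (carrier G) \<subseteq> group_center G"
    and exp: "\<And>z. z \<in> group_center G \<Longrightarrow> z [^] n = \<one>"
    and x: "x \<in> carrier G"
  shows "x [^] n \<in> group_center G"
proof -
  have "x [^] n \<otimes> y = y \<otimes> x [^] n" if y: "y \<in> carrier G" for y
  proof -
    define c where "c = group_commutator G x y"
    have c: "c \<in> group_center G" "c \<in> carrier G"
      using group_commutator_in_derived[OF x y] cl2 x y by (auto simp: c_def)
    have xy: "x \<otimes> y = y \<otimes> x \<otimes> c"
      using x y c mult_group_commutator[OF x y] by (simp add: c_def m_assoc inv_solve_left)
    \<comment> \<open>Moving \<open>y\<close> to the left past each factor \<open>x\<close> produces
      one central factor \<open>c\<close>.\<close>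
    have "x [^] m \<otimes> y = y \<otimes> x [^] m \<otimes> c [^] m" for m :: nat
    proof (induction m)
      case (Suc m)
      have "x [^] Suc m \<otimes> y = (x [^] m \<otimes> y) \<otimes> x \<otimes> c"
        using x y c xy by (simp add: m_assoc)
      also have "\<dots> = y \<otimes> x [^] m \<otimes> (c [^] m \<otimes> x) \<otimes> c"
        using x y c by (simp add: Suc m_assoc)
      also have "c [^] m \<otimes> x = x \<otimes> c [^] m"
        using x c by (metis group_centerD(2) nat_pow_comm pow_mult_distrib group_commutes_pow)
      finally show ?case using x y c by (simp add: m_assoc)
    qed (simp add: y)
    from this[of n] show ?thesis using x y exp[OF c(1)] by simp
  qed
  then show ?thesis using x by (simp add: group_center_def)
qed

section \<open>From Camina groups of class 2 to equality\<close>

lemma (in group) Camina_class_2_center: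
  assumes "camina_group G" and "derived G (carrier G) \<subseteq> group_center G"
  shows "group_center G = derived G (carrier G)"
proof (rule ccontr)
  let ?D = "derived G (carrier G)"
  assume "group_center G \<noteq> ?D"
  then obtain z where z: "z \<in> group_center G" "z \<notin> ?D" using assms(2) by blast
  \<comment> \<open>A central \<open>z\<close> has only trivial commutators, yet the Camina
    condition would make these cover the nontrivial derived subgroup.\<close>
  have "group_commutator G z g = \<one>" if "g \<in> carrier G" for g
    using that z group_centerD group_commutator_eq_one_iff by metis
  moreover have "?D \<subseteq> {group_commutator G z g | g. g \<in> carrier G}"
    using assms(1) z group_centerD(1) unfolding camina_group_def camina_pair_def by fast
  ultimately have "?D \<subseteq> {\<one>}" by auto
  moreover have "\<one> \<in> ?D" "?D \<noteq> {\<one>}"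
    using assms(1) derived_is_subgroup[of "carrier G"] subgroup.one_closed
    by (auto simp: camina_group_def camina_pair_def)
  ultimately show False by blast
qed

text \<open>\<open>\<phi>\<close> multiplies each element by a central factor, and central factors
  cancel from commutators.\<close>

lemma (in group) central_automorphism_fixes_derived:
  assumes \<phi>: "\<phi> \<in> Aut_z G" and x: "x \<in> derived G (carrier G)"
  shows "\<phi> x = x"
proof -
  have h: "\<phi> \<in> hom G G" and c: "\<And>g. g \<in> carrier G \<Longrightarrow> inv g \<otimes> \<phi> g \<in> group_center G"
    using \<phi> by (auto simp: Aut_z_def auto_def)
  interpret \<phi>: group_hom G G \<phi>
    by (simp add: h group_hom_axioms_def group_hom_def)
  \<comment> \<open>The fixed points form a subgroup, so it is enough that every commutator is
    fixed.\<close>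
  let ?F = "{x \<in> carrier G. \<phi> x = x}"
  have "subgroup ?F G" by (rule subgroupI) (auto simp: m_assoc)
  moreover have "group_commutator G g h \<in> ?F" if gh: "g \<in> carrier G" "h \<in> carrier G" for g h
  proof -
    define u v where "u = inv g \<otimes> \<phi> g" and "v = inv h \<otimes> \<phi> h"
    have uv: "u \<in> group_center G" "v \<in> group_center G" using c gh by (auto simp: u_def v_def)
    have uvG: "u \<in> carrier G" "v \<in> carrier G" 
      by (rule group_centerD(1)[OF uv(1)], rule group_centerD(1)[OF uv(2)])
    have \<phi>g: "\<phi> g = g \<otimes> u" and \<phi>h: "\<phi> h = h \<otimes> v"
      using gh by (simp_all add: u_def v_def mult_inv_cancel_left)
    \<comment> \<open>The central \<open>v\<close> cancels against its inverse, and the central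
      \<open>u\<close> moves to the right end.\<close>
    have "inv (h \<otimes> v) \<otimes> (g \<otimes> u) \<otimes> (h \<otimes> v) = inv h \<otimes> g \<otimes> h \<otimes> u"
    proof -
      have "inv (h \<otimes> v) \<otimes> (g \<otimes> u) \<otimes> (h \<otimes> v) = inv h \<otimes> inv v \<otimes> (g \<otimes> (u \<otimes> h)) \<otimes> v"
        using gh uvG uv(2) group_centerD(2)[OF uv(2), of h]
        by (simp add: m_assoc flip: inv_mult_group)
      also have "u \<otimes> h = h \<otimes> u" by (rule group_centerD(2)[OF uv(1) gh(2)])
      also have "inv h \<otimes> inv v \<otimes> (g \<otimes> (h \<otimes> u)) \<otimes> v = inv h \<otimes> (inv v \<otimes> ((g \<otimes> (h \<otimes> u)) \<otimes> v))"
        using gh uvG by (simp add: m_assoc)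
      also have "(g \<otimes> (h \<otimes> u)) \<otimes> v = v \<otimes> (g \<otimes> (h \<otimes> u))"
        using gh uvG by (intro group_centerD(2)[OF uv(2), symmetric]) simp
      also have "inv v \<otimes> (v \<otimes> (g \<otimes> (h \<otimes> u))) = g \<otimes> (h \<otimes> u)"
        using gh uvG by (simp add: mult_inv_cancel_left)
      finally show ?thesis using gh uvG by (simp add: m_assoc)
    qed
    also have "\<dots> = g \<otimes> group_commutator G g h \<otimes> u"
      using gh mult_group_commutator by simp
    also have "\<dots> = (g \<otimes> u) \<otimes> group_commutator G g h"
      using gh uvG group_centerD(2)[OF uv(1), of "group_commutator G g h"] by (simp add: m_assoc)
    finally have "group_commutator G (\<phi> g) (\<phi> h) = group_commutator G g h"
      unfolding \<phi>g \<phi>h using gh uvG by (intro iffD2[OF group_commutator_eq_iff]) simp_all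
    then show ?thesis using gh by (simp add: group_commutator_def)
  qed
  ultimately show ?thesis using derived_subset_iff x by blast
qed

text \<open>For class preserving \<open>\<phi>\<close>, \<open>inv x \<otimes> \<phi> x\<close> is a
  commutator, hence central. For central \<open>\<phi>\<close> it lies in the center, which equals
  the derived subgroup. Off that subgroup the Camina condition writes it as a commutator with
  \<open>x\<close>; on it \<open>\<phi>\<close> is the identity.\<close>

lemma (in group) Aut_c_eq_Aut_z_if_Camina_class_2:
  assumes cam: "camina_group G" and cl2: "derived G (carrier G) \<subseteq> group_center G"
  shows "Aut_c G = Aut_z G"
proof (intro equalityI subsetI)
  fix \<phi> assume \<phi>: "\<phi> \<in> Aut_c G"
  have "inv x \<otimes> \<phi> x \<in> group_center G" if x: "x \<in> carrier G" for x
  proof -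
    obtain g where g: "g \<in> carrier G" "\<phi> x = inv g \<otimes> x \<otimes> g"
      using \<phi> x by (auto simp: Aut_c_def conjugate_in_def)
    then have "inv x \<otimes> \<phi> x = group_commutator G x g"
      using x by (simp add: group_commutator_def m_assoc)
    then show ?thesis using group_commutator_in_derived[OF x g(1)] cl2 by auto
  qed
  then show "\<phi> \<in> Aut_z G" using \<phi> by (simp add: Aut_c_def Aut_z_def)
next
  let ?D = "derived G (carrier G)"
  fix \<phi> assume \<phi>: "\<phi> \<in> Aut_z G"
  have "conjugate_in G x (\<phi> x)" if x: "x \<in> carrier G" for x
  proof (cases "x \<in> ?D")
    case True
    then have "\<phi> x = inv \<one> \<otimes> x \<otimes> \<one>"
      using central_automorphism_fixes_derived[OF \<phi>] x by simp
    then show ?thesis unfolding conjugate_in_def by blast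
  next
    case False
    have "\<phi> x \<in> carrier G" using \<phi> x by (auto simp: Aut_z_def auto_def hom_def)
    then have "\<phi> x = x \<otimes> (inv x \<otimes> \<phi> x)" using x by (simp flip: m_assoc)
    moreover have w: "inv x \<otimes> \<phi> x \<in> group_center G" using \<phi> x by (simp add: Aut_z_def)
    moreover have "?D \<subseteq> {group_commutator G x g | g. g \<in> carrier G}"
      using cam x False unfolding camina_group_def camina_pair_def by blast
    ultimately show ?thesis
      using conjugate_in_mult_iff[OF x group_centerD(1)[OF w]] Camina_class_2_center[OF cam cl2]
      by auto
  qed
  then show "\<phi> \<in> Aut_c G" using \<phi> by (simp add: Aut_c_def Aut_z_def)
qed

section \<open>From equality to Camina groups of class 2\<close>

lemma (in group) class_2_if_Aut_c_subset_Aut_z: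
  assumes "Aut_c G \<subseteq> Aut_z G"
  shows "derived G (carrier G) \<subseteq> group_center G"
  unfolding derived_subset_iff[OF center_subgroup]
proof (intro ballI)
  fix x y assume xy: "x \<in> carrier G" "y \<in> carrier G"
  \<comment> \<open>Conjugation by \<open>y\<close> is class preserving, hence central, and it
    multiplies \<open>x\<close> by exactly the commutator of \<open>x\<close> and
    \<open>y\<close>.\<close>
  then have "(\<lambda>x\<in>carrier G. inv y \<otimes> x \<otimes> y) \<in> Aut_z G"
    using conjugation_in_Aut_c assms by blast
  then show "group_commutator G x y \<in> group_center G"
    using xy by (auto simp: Aut_z_def group_commutator_def m_assoc)
qed

lemma (in group) Camina_if_Aut_z_subset_Aut_c:
  fixes p :: nat
  assumes fin: "finite (carrier G)" and p: "Factorial_Ring.prime p"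
    and nonab: "\<not> comm_group G"
    and exp: "\<And>z. z \<in> group_center G \<Longrightarrow> z [^] p = \<one>"
    and cl2: "derived G (carrier G) \<subseteq> group_center G"
    and sub: "Aut_z G \<subseteq> Aut_c G"
  shows "camina_group G"
proof -
  let ?D = "derived G (carrier G)" and ?Z = "group_center G"
  \<comment> \<open>\<open>S\<close> generates the smallest normal subgroup whose quotient is
    abelian of exponent dividing \<open>p\<close>; in a finite \<open>p\<close>-group this is the
    Frattini subgroup.\<close>
  define S where "S = ?D \<union> {x [^] p | x. x \<in> carrier G}"
  define H where "H = generate G S"
  have "S \<subseteq> ?Z" using cl2 class_2_pow_central[OF cl2 exp] by (auto simp: S_def)
  then have "S \<subseteq> carrier G" using subgroup.subset[OF center_subgroup] by blast
  then have subH: "subgroup H G" unfolding H_def by (rule generate_is_subgroup)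
  have HZ: "H \<subseteq> ?Z"
    unfolding H_def using \<open>S \<subseteq> ?Z\<close> by (rule generate_subgroup_incl[OF _ center_subgroup])
  interpret H: normal H G by (rule central_subgroup_normal[OF subH HZ])
  have DH: "?D \<subseteq> H" by (auto simp: H_def S_def intro: generate.incl)
  have pH: "x [^] p \<in> H" if "x \<in> carrier G" for x
    using that by (auto simp: H_def S_def intro: generate.incl)
  \<comment> \<open>Some central automorphism sends \<open>x\<close> to
    \<open>x \<otimes> w\<close>. It is class preserving by \<open>sub\<close>, so \<open>w\<close>
    is a commutator with \<open>x\<close>.\<close>
  have key: "w \<in> {group_commutator G x g | g. g \<in> carrier G}"
    if x: "x \<in> carrier G" "x \<notin> H" and w: "w \<in> H" for x w
  proof -
    obtain \<phi> where "\<phi> \<in> Aut_z G" "\<phi> x = x \<otimes> w"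
      using H.central_automorphism[OF fin p DH pH x w] w HZ exp by blast
    then have "conjugate_in G x (\<phi> x)" using sub x unfolding Aut_c_def by blast
    then have "conjugate_in G x (x \<otimes> w)" using \<open>\<phi> x = x \<otimes> w\<close> by simp
    then show ?thesis using conjugate_in_mult_iff x(1) H.mem_carrier[OF w] by blast
  qed
  have D1: "?D \<noteq> {\<one>}" using nonab derived_eq_one_iff by simp
  moreover have "\<one> \<in> ?D"
    using derived_is_subgroup[of "carrier G"] by (simp add: subgroup.one_closed)
  ultimately obtain w where w: "w \<in> ?D" "w \<noteq> \<one>" by blast
  \<comment> \<open>For a central \<open>z\<close> outside \<open>H\<close>, \<open>key\<close>
    would make the nontrivial \<open>w\<close> a commutator with \<open>z\<close>.\<close>
  have "?Z \<subseteq> H"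
  proof
    fix z assume z: "z \<in> ?Z"
    show "z \<in> H"
    proof (rule ccontr)
      assume "z \<notin> H"
      then obtain g where g: "g \<in> carrier G" "w = group_commutator G z g"
        using key[OF group_centerD(1)[OF z], of w] w DH by blast
      then show False
        using w group_commutator_eq_one_iff[OF group_centerD(1)[OF z]] group_centerD(2)[OF z] by simp
    qed
  qed
  then have ZH: "?Z = H" using HZ by blast
  have "?Z \<noteq> carrier G"
  proof
    assume Z: "?Z = carrier G"
    then have "comm_group G"
      by (intro group_comm_groupI) (auto intro: group_centerD(2))
    then show False using nonab by blast
  qed
  then obtain x where x: "x \<in> carrier G" "x \<notin> H"
    using ZH subgroup.subset[OF center_subgroup] by blast
  have "H \<subseteq> ?D" using key[OF x] x(1) group_commutator_in_derived by blast
  then have "H = ?D" using DH by blast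
  \<comment> \<open>Now center, \<open>H\<close> and derived subgroup coincide, and
    \<open>key\<close> is the Camina condition itself.\<close>
  then show ?thesis
    using derived_self_is_normal D1 \<open>?Z \<noteq> carrier G\<close> ZH key
    unfolding camina_group_def camina_pair_def by blast
qed

theorem theorem3p3:
  fixes G :: "('a, 'b) monoid_scheme" and p :: nat
  assumes "Factorial_Ring.prime p"
    and "finite_p_group p G"
    and "\<not> comm_group G"
    and "elementary_abelian p (G\<lparr>carrier := group_center G\<rparr>)"
  shows "Aut_c G = Aut_z G \<longleftrightarrow>
    camina_group G \<and> nilpotent_group G \<and> nilpotency_class G = 2"
proof -
  interpret group G using assms(2) by (simp add: finite_p_group_def)
  have fin: "finite (carrier G)" using assms(2) by (simp add: finite_p_group_def)
  \<comment> \<open>Restricting the carrier to the center leaves product and unit unchanged, so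
    powers agree with those in \<open>G\<close>.\<close>
  have exp: "z [^]\<^bsub>G\<^esub> p = \<one>\<^bsub>G\<^esub>" if "z \<in> group_center G" for z
    using that assms(4) by (simp add: elementary_abelian_def nat_pow_def)
  show ?thesis
    using nilpotency_class_2_iff[OF assms(3)] Aut_c_eq_Aut_z_if_Camina_class_2
      class_2_if_Aut_c_subset_Aut_z Camina_if_Aut_z_subset_Aut_c[OF fin assms(1,3) exp]
    by blast
qed

end
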